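(* Let $a,b,c,d$ be positive real numbers with $\min\{c,d\}>\max\{a,b\}$, and let $\{P_n(x)\}_{n\in\mathbb{N}}$, $P_n(x):=P_n(x;a,b;c,d)$, be the monic $2$-orthogonal polynomial sequence with respect to the weight vector $\overline{\mathcal{W}}(x;a,b;c,d)$. Then, for all $n\in\mathbb{N}$, $$x^2(1-x)P_n'''(x)-x\,\varphi(x)P_n''(x)+\psi_n(x)P_n'(x)+n\lambda_nP_n(x)=0,$$ with $$\varphi(x)=(c+d+2)x-(a+b+1),\qquad \psi_n(x)=\big((n-1)(c+d+n)-\lambda_n\big)x+ab,$$ $$\lambda_n=\left(c+\left\lfloor\frac n2\right\rfloor\right)\left(d+\left\lfloor\frac{n-1}{2}\right\rfloor\right).$$
   Context: $\mathbb{N}=\{0,1,2,\dots\}$. For positive reals $a,b,c,d$ with $\delta:=c+d-a-b>0$, the function $\mathcal{W}(\cdot\,;a,b;c,d)$ on $(0,1)$ is $$\mathcal{W}(x;a,b;c,d)=\frac{\Gamma(c)\Gamma(d)}{\Gamma(a)\Gamma(b)\Gamma(\delta)}\,x^{a-1}(1-x)^{\delta-1}\,{}_2F_1(c-b,d-b;\delta;1-x),$$ where ${}_2F_1(\alpha,\beta;\gamma;z)=\sum_{n\ge0}\frac{(\alpha)_n(\beta)_n}{(\gamma)_n}\frac{z^n}{n!}$ for $|z|<1$, with $(z)_0=1$, $(z)_n=z(z+1)\cdots(z+n-1)$. (The condition $\min\{c,d\}>\max\{a,b\}$ implies $\delta>0$.) The weight vector $\overline{\mathcal{W}}(x;a,b;c,d)$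 has components $w_0(x)=\mathcal{W}(x;a,b;c,d)$ and $w_1(x)=\mathcal{W}(x;a,b+1;c+1,d)$. A sequence of monic polynomials $\{P_n\}_{n\in\mathbb{N}}$ with $\deg P_n=n$ is the monic $2$-orthogonal polynomial sequence with respect to $\overline{\mathcal{W}}(x;a,b;c,d)$ if, for each $j\in\{0,1\}$ and $k,n\in\mathbb{N}$, $\int_0^1x^kP_n(x)w_j(x)\,\mathrm{d}x$ equals $0$ if $n\ge 2k+j+1$ and is nonzero if $n=2k+j$. For these weights it exists and is unique. *)

theory Defs
  imports "HOL-Analysis.Analysis" "HOL-Computational_Algebra.Polynomial"
begin

definition hypergeo_2F1 :: "real \<Rightarrow> real \<Rightarrow> real \<Rightarrow> real \<Rightarrow> real" where
  "hypergeo_2F1 \<alpha> \<beta> \<gamma> z =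
     (\<Sum>n. pochhammer \<alpha> n * pochhammer \<beta> n / pochhammer \<gamma> n * (z ^ n / fact n))"

text \<open>Meaningful for positive \<open>a, b, c, d\<close> with \<open>c + d - a - b > 0\<close> and \<open>0 < x < 1\<close>.\<close>

definition weight :: "real \<Rightarrow> real \<Rightarrow> real \<Rightarrow> real \<Rightarrow> real \<Rightarrow> real" where
  "weight a b c d x =
     (let \<delta> = c + d - a - b in
       Gamma c * Gamma d / (Gamma a * Gamma b * Gamma \<delta>)
         * x powr (a - 1) * (1 - x) powr (\<delta> - 1)
         * hypergeo_2F1 (c - b) (d - b) \<delta> (1 - x))"

text \<open>The components of the weight vector; only the indices \<open>0\<close> and \<open>1\<close> are relevant.\<close>

definition weight_vector :: "real \<Rightarrow> real \<Rightarrow> real \<Rightarrow> real \<Rightarrow> nat \<Rightarrow> real \<Rightarrow> real" where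
  "weight_vector a b c d j =
     (if j = 0 then weight a b c d else weight a (b + 1) (c + 1) d)"

definition monic_2_orthogonal ::
    "(nat \<Rightarrow> real \<Rightarrow> real) \<Rightarrow> (nat \<Rightarrow> real poly) \<Rightarrow> bool" where
  "monic_2_orthogonal w P \<longleftrightarrow>
     (\<forall>n. degree (P n) = n \<and> lead_coeff (P n) = 1) \<and>
     (\<forall>j\<in>{0, 1}. \<forall>k n.
        (n \<ge> 2 * k + j + 1 \<longrightarrow>
           (LBINT x:{0<..<1}. x ^ k * poly (P n) x * w j x) = 0) \<and>
        (n = 2 * k + j \<longrightarrow>
           (LBINT x:{0<..<1}. x ^ k * poly (P n) x * w j x) \<noteq> 0))"

text \<open>The floors are taken in the integers: for \<open>n = 0\<close> the second one is \<open>-1\<close>.\<close>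

definition lambda_coeff :: "real \<Rightarrow> real \<Rightarrow> nat \<Rightarrow> real" where
  "lambda_coeff c d n =
     (c + of_int \<lfloor>real n / 2\<rfloor>) * (d + of_int \<lfloor>(real n - 1) / 2\<rfloor>)"

definition phi_coeff :: "real \<Rightarrow> real \<Rightarrow> real \<Rightarrow> real \<Rightarrow> real \<Rightarrow> real" where
  "phi_coeff a b c d x = (c + d + 2) * x - (a + b + 1)"

definition psi_coeff :: "real \<Rightarrow> real \<Rightarrow> real \<Rightarrow> real \<Rightarrow> nat \<Rightarrow> real \<Rightarrow> real" where
  "psi_coeff a b c d n x =
     ((real n - 1) * (c + d + real n) - lambda_coeff c d n) * x + a * b"

end

theory Submission
  imports Defs "HOL-Real_Asymp.Real_Asymp"
begin

text \<open>
  Integrating the series of the weight termwise against \<open>x\<^sup>k\<close> gives Beta integrals, and the resulting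
  series in \<open>\<gamma> = a + \<delta> + k\<close> satisfies the contiguous relation behind Gauss's summation theorem, which
  telescopes. Hence the moments of \<open>w\<^sub>j\<close> are proportional to
  \<open>(a)\<^sub>k (b)\<^bsub>k+j\<^esub> / ((c)\<^bsub>k+j\<^esub> (d)\<^sub>k)\<close>. Integrating
  \<open>\<^sub>3F\<^sub>2(-n, c + \<lfloor>n/2\<rfloor>, d + \<lfloor>(n-1)/2\<rfloor>; a, b; x)\<close> against \<open>x\<^sup>k w\<^sub>j\<close> therefore yields an \<open>n\<close>-th finite
  difference of a polynomial of degree less than \<open>n\<close>, which vanishes. The nonvanishing conditions in
  the definition of 2-orthogonality make the monic solution of these equations unique, so \<open>P\<^sub>n\<close> is a
  multiple of this \<open>\<^sub>3F\<^sub>2\<close>, whose hypergeometric equation is the claimed one.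
\<close>


section \<open>Coefficients and convergence of the Gauss hypergeometric series\<close>

definition hypergeo_coeff :: "real \<Rightarrow> real \<Rightarrow> real \<Rightarrow> nat \<Rightarrow> real" where
  "hypergeo_coeff \<alpha> \<beta> \<gamma> n = pochhammer \<alpha> n * pochhammer \<beta> n / (pochhammer \<gamma> n * fact n)"

lemma hypergeo_2F1_eq: "hypergeo_2F1 \<alpha> \<beta> \<gamma> z = (\<Sum>n. hypergeo_coeff \<alpha> \<beta> \<gamma> n * z ^ n)"
  by (simp add: hypergeo_2F1_def hypergeo_coeff_def)

lemma hypergeo_coeff_Suc:
  "hypergeo_coeff \<alpha> \<beta> \<gamma> (Suc n) =
     hypergeo_coeff \<alpha> \<beta> \<gamma> n * ((\<alpha> + real n) * (\<beta> + real n) / ((\<gamma> + real n) * (real n + 1)))"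
  by (simp add: hypergeo_coeff_def pochhammer_Suc mult_ac add_ac)

text \<open>The sequence is exactly a quotient of three \<open>rGamma_series\<close>, each of which
  converges to a value of \<open>rGamma\<close>. Since \<open>rGamma_series z n\<close> contains
  \<open>pochhammer z (n + 1)\<close> but \<open>fact n\<close>, the coefficient appears at
  \<open>Suc n\<close> with the factor \<open>Suc n\<close>.\<close>

lemma hypergeo_coeff_asymp:
  assumes "\<gamma> > 0"
  shows "(\<lambda>n. real (Suc n) * hypergeo_coeff \<alpha> \<beta> \<gamma> (Suc n) * exp ((\<gamma> - \<alpha> - \<beta>) * ln (real n)))
           \<longlonglongrightarrow> rGamma \<alpha> * rGamma \<beta> / rGamma \<gamma>"
proof -
  have "real (Suc n) * hypergeo_coeff \<alpha> \<beta> \<gamma> (Suc n) * exp ((\<gamma> - \<alpha> - \<beta>) * ln (real n)) =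
      rGamma_series \<alpha> n * rGamma_series \<beta> n / rGamma_series \<gamma> n" for n
  proof -
    have "exp ((\<gamma> - \<alpha> - \<beta>) * ln (real n)) =
        exp (\<gamma> * ln (real n)) / (exp (\<alpha> * ln (real n)) * exp (\<beta> * ln (real n)))"
      by (simp add: left_diff_distrib exp_diff)
    then show ?thesis
      by (simp add: hypergeo_coeff_def rGamma_series_def mult_ac del: of_nat_Suc)
  qed
  moreover have "rGamma \<gamma> \<noteq> 0"
    using Gamma_real_pos[OF assms] by (simp add: rGamma_inverse_Gamma)
  ultimately show ?thesis
    by (auto intro!: tendsto_intros)
qed

text \<open>With s = \<gamma> - \<alpha> - \<beta> > 0 the coefficients are O(n powr (-s-1)), so the
  series converges absolutely at the boundary point 1. The second claim supplies the vanishing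
  boundary term of a telescoping sum.\<close>

lemma hypergeo_coeff_summable:
  assumes "\<gamma> > 0" "\<gamma> - \<alpha> - \<beta> > 0"
  shows "summable (\<lambda>n. \<bar>hypergeo_coeff \<alpha> \<beta> \<gamma> n\<bar>)"
    and "(\<lambda>n. real n * hypergeo_coeff \<alpha> \<beta> \<gamma> n) \<longlonglongrightarrow> 0"
proof -
  define s where "s = \<gamma> - \<alpha> - \<beta>"
  have s: "s > 0" using assms by (simp add: s_def)
  let ?g = "\<lambda>n. real (Suc n) * hypergeo_coeff \<alpha> \<beta> \<gamma> (Suc n) * exp (s * ln (real n))"
  have lim: "?g \<longlonglongrightarrow> rGamma \<alpha> * rGamma \<beta> / rGamma \<gamma>"
    using hypergeo_coeff_asymp[OF assms(1), of \<alpha> \<beta>] by (simp add: s_def)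
  have "Bseq ?g" by (rule convergent_imp_Bseq[OF convergentI[OF lim]])
  then obtain K where K: "\<And>n. \<bar>?g n\<bar> \<le> K"
    unfolding Bseq_def real_norm_def by blast
  have bound: "\<bar>hypergeo_coeff \<alpha> \<beta> \<gamma> (Suc n)\<bar> \<le> K * real n powr (- s - 1)" if "n \<ge> 1" for n
  proof -
    have "real n * \<bar>hypergeo_coeff \<alpha> \<beta> \<gamma> (Suc n)\<bar> * exp (s * ln (real n)) \<le> \<bar>?g n\<bar>"
      by (simp add: abs_mult mult_right_mono)
    also have "\<dots> \<le> K" by (rule K)
    finally have "\<bar>hypergeo_coeff \<alpha> \<beta> \<gamma> (Suc n)\<bar> * (real n powr (s + 1)) \<le> K"
      using that by (simp add: powr_def distrib_right exp_add mult_ac)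
    then have "\<bar>hypergeo_coeff \<alpha> \<beta> \<gamma> (Suc n)\<bar> \<le> K / real n powr (s + 1)"
      using that by (simp add: pos_le_divide_eq)
    also have "\<dots> = K * real n powr (- (s + 1))"
      by (simp only: powr_minus divide_inverse)
    finally show ?thesis by simp
  qed
  have "summable (\<lambda>n. K * real n powr (- s - 1))"
    by (intro summable_mult) (use s in \<open>simp add: summable_real_powr_iff\<close>)
  then have "summable (\<lambda>n. \<bar>hypergeo_coeff \<alpha> \<beta> \<gamma> (Suc n)\<bar>)"
    by (rule summable_comparison_test'[where N = 1]) (use bound in auto)
  then show "summable (\<lambda>n. \<bar>hypergeo_coeff \<alpha> \<beta> \<gamma> n\<bar>)"
    by (subst (asm) summable_Suc_iff)
  \<comment> \<open>Multiplying the convergent sequence \<open>?g\<close> by the null sequence n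
    powr (-s) cancels the exponential and leaves only the weighted coefficients.\<close>
  have "(\<lambda>n. ?g n * exp (- s * ln (real n))) \<longlonglongrightarrow> rGamma \<alpha> * rGamma \<beta> / rGamma \<gamma> * 0"
  proof (rule tendsto_mult[OF lim])
    have "(\<lambda>n. real n powr (- s)) \<longlonglongrightarrow> 0"
      by (intro tendsto_neg_powr filterlim_real_sequentially) (use s in auto)
    then show "(\<lambda>n. exp (- s * ln (real n))) \<longlonglongrightarrow> 0"
      by (rule Lim_transform_eventually)
         (auto intro!: eventually_mono[OF eventually_gt_at_top[of 0]] simp: powr_def)
  qed
  then have "(\<lambda>n. real (Suc n) * hypergeo_coeff \<alpha> \<beta> \<gamma> (Suc n)) \<longlonglongrightarrow> 0"
    by (simp add: mult.assoc flip: exp_add)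
  then show "(\<lambda>n. real n * hypergeo_coeff \<alpha> \<beta> \<gamma> n) \<longlonglongrightarrow> 0"
    by (subst (asm) filterlim_sequentially_Suc)
qed

text \<open>Termwise, the difference of the two sides is \<open>?t (Suc n) - ?t n\<close>, where
  \<open>?t\<close> is \<gamma> n times the n-th coefficient. As \<open>?t\<close> is 0 at n = 0 and
  tends to 0, the sum telescopes to 0. Applied with \<gamma> = a + k + \<delta>, the relation links
  consecutive moments.\<close>

lemma hypergeo_coeff_contiguous:
  assumes "\<gamma> > 0" "\<gamma> - \<alpha> - \<beta> > 0"
  shows "(\<gamma> - \<alpha>) * (\<gamma> - \<beta>) * (\<Sum>n. hypergeo_coeff \<alpha> \<beta> (\<gamma> + 1) n) =
         \<gamma> * (\<gamma> - \<alpha> - \<beta>) * (\<Sum>n. hypergeo_coeff \<alpha> \<beta> \<gamma> n)"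
proof -
  let ?u = "hypergeo_coeff \<alpha> \<beta> \<gamma>" and ?v = "hypergeo_coeff \<alpha> \<beta> (\<gamma> + 1)"
  let ?t = "\<lambda>n. \<gamma> * (real n * ?u n)"
  have v: "?v n = ?u n * (\<gamma> / (\<gamma> + real n))" for n
  proof -
    have "\<gamma> * pochhammer (\<gamma> + 1) n = pochhammer \<gamma> n * (\<gamma> + real n)"
      by (metis pochhammer_rec pochhammer_Suc)
    then have "pochhammer (\<gamma> + 1) n = pochhammer \<gamma> n * ((\<gamma> + real n) / \<gamma>)"
      using assms by (simp add: eq_divide_eq mult.commute)
    then show ?thesis
      by (simp add: hypergeo_coeff_def mult_ac)
  qed
  have step: "(\<gamma> - \<alpha>) * (\<gamma> - \<beta>) * ?v n - \<gamma> * (\<gamma> - \<alpha> - \<beta>) * ?u n = ?t (Suc n) - ?t n" for n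
  proof -
    have "\<gamma> + real n \<noteq> 0" "real n + 1 \<noteq> 0" using assms by auto
    then show ?thesis
      unfolding v hypergeo_coeff_Suc of_nat_Suc
      by (simp add: divide_simps) algebra
  qed
  have su: "summable ?u" and sv: "summable ?v"
    using hypergeo_coeff_summable(1)[of \<gamma> \<alpha> \<beta>] hypergeo_coeff_summable(1)[of "\<gamma> + 1" \<alpha> \<beta>] assms
    by (auto intro: summable_rabs_cancel)
  have "?t \<longlonglongrightarrow> \<gamma> * 0"
    by (intro tendsto_mult tendsto_const hypergeo_coeff_summable assms)
  then have "(\<lambda>n. ?t (Suc n) - ?t n) sums 0"
    using telescope_sums[of ?t 0] by simp
  moreover have "(\<lambda>n. (\<gamma> - \<alpha>) * (\<gamma> - \<beta>) * ?v n - \<gamma> * (\<gamma> - \<alpha> - \<beta>) * ?u n) sums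
      ((\<gamma> - \<alpha>) * (\<gamma> - \<beta>) * suminf ?v - \<gamma> * (\<gamma> - \<alpha> - \<beta>) * suminf ?u)"
    by (intro sums_diff sums_mult summable_sums su sv)
  ultimately have "0 = (\<gamma> - \<alpha>) * (\<gamma> - \<beta>) * suminf ?v - \<gamma> * (\<gamma> - \<alpha> - \<beta>) * suminf ?u"
    unfolding step by (rule sums_unique2)
  then show ?thesis by simp
qed

lemma hypergeo_series_summable:
  assumes "\<gamma> > 0" "\<bar>z\<bar> < 1"
  shows "summable (\<lambda>n. \<bar>hypergeo_coeff \<alpha> \<beta> \<gamma> n * z ^ n\<bar>)"
proof -
  \<comment> \<open>The coefficient ratio tends to 1, so any number strictly between |z| and 1
    serves in the ratio test; the midpoint is taken.\<close>
  define r where "r = (\<bar>z\<bar> + 1) / 2"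
  let ?q = "\<lambda>n. \<bar>(\<alpha> + real n) * (\<beta> + real n) / ((\<gamma> + real n) * (real n + 1))\<bar> * \<bar>z\<bar>"
  have "?q \<longlonglongrightarrow> \<bar>1\<bar> * \<bar>z\<bar>"
    by (intro tendsto_intros) real_asymp
  moreover have "\<bar>1\<bar> * \<bar>z\<bar> < r" using assms by (simp add: r_def)
  ultimately have "eventually (\<lambda>n. ?q n < r) sequentially"
    by (rule order_tendstoD(2))
  then obtain N where N: "\<And>n. n \<ge> N \<Longrightarrow> ?q n < r"
    by (auto simp: eventually_at_top_linorder)
  show ?thesis
  proof (rule summable_ratio_test)
    show "r < 1" using assms by (simp add: r_def)
    fix n assume n: "n \<ge> N"
    have "\<bar>hypergeo_coeff \<alpha> \<beta> \<gamma> (Suc n) * z ^ Suc n\<bar> =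
        \<bar>hypergeo_coeff \<alpha> \<beta> \<gamma> n * z ^ n\<bar> * ?q n"
      by (simp only: hypergeo_coeff_Suc power_Suc abs_mult mult_ac)
    also have "\<dots> \<le> \<bar>hypergeo_coeff \<alpha> \<beta> \<gamma> n * z ^ n\<bar> * r"
      using N[OF n] by (intro mult_left_mono) auto
    finally show "norm \<bar>hypergeo_coeff \<alpha> \<beta> \<gamma> (Suc n) * z ^ Suc n\<bar>
        \<le> r * norm \<bar>hypergeo_coeff \<alpha> \<beta> \<gamma> n * z ^ n\<bar>"
      by (simp add: mult.commute)
  qed
qed

section \<open>Beta integrals and the moments of the weights\<close>

lemma Beta_integral_Ioo:
  assumes "a > 0" "b > (0::real)"
  shows "set_integrable lborel {0<..<1} (\<lambda>x. x powr (a - 1) * (1 - x) powr (b - 1))"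
    and "(LBINT x:{0<..<1}. x powr (a - 1) * (1 - x) powr (b - 1)) = Beta a b"
proof -
  show int: "set_integrable lborel {0<..<1} (\<lambda>x. x powr (a - 1) * (1 - x) powr (b - 1))"
    by (rule set_integrable_subset[OF integrable_Beta[OF assms]]) auto
  have "((\<lambda>x. x powr (a - 1) * (1 - x) powr (b - 1)) has_integral Beta a b) {0<..<1}"
    using has_integral_Beta_real[OF assms] by (simp add: has_integral_Icc_iff_Ioo)
  then show "(LBINT x:{0<..<1}. x powr (a - 1) * (1 - x) powr (b - 1)) = Beta a b"
    using set_borel_integral_eq_integral(2)[OF int] by (simp add: integral_unique)
qed

lemma Beta_add_nat:
  assumes "a > 0" "b > (0::real)"
  shows "Beta a (b + real n) = Beta a b * pochhammer b n / pochhammer (a + b) n"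
proof -
  have G: "Gamma (x + real n) = Gamma x * pochhammer x n" if "x > 0" for x :: real
  proof -
    have "x \<notin> \<int>\<^sub>\<le>\<^sub>0" using that by (auto elim!: nonpos_Ints_cases)
    then show ?thesis using pochhammer_Gamma[of x n] Gamma_real_pos[OF that] by simp
  qed
  show ?thesis
    using assms G[of b] G[of "a + b"] by (simp add: Beta_def add_ac)
qed

text \<open>Termwise integration is justified by summability of the L1 norms of the terms. The
  hypothesis a + \<delta> - \<alpha> - \<beta> > 0 is the convergence condition at 1 for the series
  that results.\<close>

lemma moment_of_hypergeo:
  assumes "a > 0" "\<delta> > 0" "a + \<delta> - \<alpha> - \<beta> > 0"
  defines "f \<equiv> \<lambda>x. x powr (a - 1) * (1 - x) powr (\<delta> - 1) * hypergeo_2F1 \<alpha> \<beta> \<delta> (1 - x)"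
  shows "set_integrable lborel {0<..<1} f"
    and "(LBINT x:{0<..<1}. f x) = Beta a \<delta> * (\<Sum>n. hypergeo_coeff \<alpha> \<beta> (a + \<delta>) n)"
proof -
  \<comment> \<open>The kernel is kept apart from its coefficient because it is nonnegative: the L1
    norm of each term is then a Beta value times the absolute value of a coefficient of arbitrary
    sign.\<close>
  define g where "g n x = indicator {0<..<1} x *
     (x powr (a - 1) * (1 - x) powr (\<delta> + real n - 1))" for n and x :: real
  define F where "F n x = hypergeo_coeff \<alpha> \<beta> \<delta> n * g n x" for n x
  have g: "integrable lborel (g n)" "integral\<^sup>L lborel (g n) = Beta a (\<delta> + real n)" for n
    using Beta_integral_Ioo[of a "\<delta> + real n"] assms
    by (simp_all add: set_integrable_def set_lebesgue_integral_def g_def[abs_def])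
  have g_nonneg: "g n x \<ge> 0" for n x
    by (simp add: g_def indicator_def)
  \<comment> \<open>The Beta factor replaces the denominator \<open>pochhammer \<delta> n\<close> by
    \<open>pochhammer (a + \<delta>) n\<close>.\<close>
  have coeff: "hypergeo_coeff \<alpha> \<beta> \<delta> n * Beta a (\<delta> + real n) =
      Beta a \<delta> * hypergeo_coeff \<alpha> \<beta> (a + \<delta>) n" for n
  proof -
    have "pochhammer \<delta> n > 0" using assms by (simp add: pochhammer_pos)
    then show ?thesis using assms by (simp add: Beta_add_nat hypergeo_coeff_def mult_ac)
  qed
  have F_eq: "F n x = indicator {0<..<1} x * (x powr (a - 1) * (1 - x) powr (\<delta> - 1)) *
      (hypergeo_coeff \<alpha> \<beta> \<delta> n * (1 - x) ^ n)" for n x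
  proof (cases "x \<in> {0<..<1}")
    case True
    then have "(1 - x) powr (\<delta> + real n - 1) = (1 - x) powr (\<delta> - 1) * (1 - x) ^ n"
      using powr_add[of "1 - x" "\<delta> - 1" "real n"] by (simp add: powr_realpow algebra_simps)
    then show ?thesis by (simp add: F_def g_def)
  qed (simp add: F_def g_def)
  have sum: "(\<Sum>n. F n x) = indicator {0<..<1} x * f x" for x
  proof (cases "x \<in> {0<..<1}")
    case True
    then have "summable (\<lambda>n. hypergeo_coeff \<alpha> \<beta> \<delta> n * (1 - x) ^ n)"
      by (intro summable_rabs_cancel[OF hypergeo_series_summable]) (use assms in auto)
    then show ?thesis by (simp add: F_eq f_def suminf_mult hypergeo_2F1_eq)
  qed (simp add: F_eq)
  have int: "integrable lborel (F n)" for n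
    using g by (simp add: F_def[abs_def])
  have AE: "AE x in lborel. summable (\<lambda>n. norm (F n x))"
  proof (rule AE_I2)
    fix x :: real
    show "summable (\<lambda>n. norm (F n x))"
    proof (cases "x \<in> {0<..<1}")
      case True
      then have "summable (\<lambda>n. \<bar>hypergeo_coeff \<alpha> \<beta> \<delta> n * (1 - x) ^ n\<bar>)"
        by (intro hypergeo_series_summable) (use assms in auto)
      then show ?thesis
        unfolding F_eq real_norm_def abs_mult by (intro summable_mult) (simp add: abs_mult)
    qed (simp add: F_eq)
  qed
  have "(\<integral>x. norm (F n x) \<partial>lborel) = \<bar>Beta a \<delta>\<bar> * \<bar>hypergeo_coeff \<alpha> \<beta> (a + \<delta>) n\<bar>" for n
  proof -
    have B: "Beta a (\<delta> + real n) \<ge> 0"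
      unfolding g(2)[of n, symmetric] by (rule Bochner_Integration.integral_nonneg[OF g_nonneg])
    have "(\<integral>x. norm (F n x) \<partial>lborel) = \<bar>hypergeo_coeff \<alpha> \<beta> \<delta> n\<bar> * Beta a (\<delta> + real n)"
      using g(2)[of n] g_nonneg by (simp add: F_def abs_mult)
    also have "\<dots> = \<bar>hypergeo_coeff \<alpha> \<beta> \<delta> n * Beta a (\<delta> + real n)\<bar>"
      using B by (simp add: abs_mult)
    finally show ?thesis by (simp add: coeff abs_mult)
  qed
  then have summable: "summable (\<lambda>n. \<integral>x. norm (F n x) \<partial>lborel)"
    using hypergeo_coeff_summable(1)[of "a + \<delta>" \<alpha> \<beta>] assms by (simp add: summable_mult)
  show "set_integrable lborel {0<..<1} f"
    using integrable_suminf[OF int AE summable] by (simp add: sum set_integrable_def)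
  have "(LBINT x:{0<..<1}. f x) = (\<Sum>n. integral\<^sup>L lborel (F n))"
    using integral_suminf[OF int AE summable] by (simp add: sum set_lebesgue_integral_def)
  also have "\<dots> = (\<Sum>n. Beta a \<delta> * hypergeo_coeff \<alpha> \<beta> (a + \<delta>) n)"
    using g by (simp add: F_def[abs_def] coeff)
  also have "\<dots> = Beta a \<delta> * (\<Sum>n. hypergeo_coeff \<alpha> \<beta> (a + \<delta>) n)"
    by (rule suminf_mult[OF summable_rabs_cancel[OF hypergeo_coeff_summable(1)]])
       (use assms in auto)
  finally show "(LBINT x:{0<..<1}. f x) = Beta a \<delta> * (\<Sum>n. hypergeo_coeff \<alpha> \<beta> (a + \<delta>) n)" .
qed


text \<open>The power x^k only replaces a by a + k in the integrand and leaves \<delta> fixed. The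
  contiguous relation and the recurrence of Beta then give a first-order recurrence in k; the total
  mass stays as an unevaluated factor.\<close>

lemma weight_moments:
  fixes a b c d :: real
  assumes pos: "a > 0" "b > 0" "c > 0" "d > 0" and \<delta>: "c + d - a - b > 0"
  shows "set_integrable lborel {0<..<1} (\<lambda>x. x ^ k * weight a b c d x)"
    and "(LBINT x:{0<..<1}. x ^ k * weight a b c d x) =
      (LBINT x:{0<..<1}. weight a b c d x) *
      (pochhammer a k * pochhammer b k / (pochhammer c k * pochhammer d k))"
proof -
  define \<delta> where "\<delta> = c + d - a - b"
  define C where "C = Gamma c * Gamma d / (Gamma a * Gamma b * Gamma \<delta>)"
  define h where "h k x = x powr (a + real k - 1) * (1 - x) powr (\<delta> - 1) *
      hypergeo_2F1 (c - b) (d - b) \<delta> (1 - x)" for k x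
  define S where "S k = (\<Sum>n. hypergeo_coeff (c - b) (d - b) (a + real k + \<delta>) n)" for k
  define \<mu> where "\<mu> k = (LBINT x:{0<..<1}. x ^ k * weight a b c d x)" for k
  have \<delta>_pos: "\<delta> > 0" using \<delta> by (simp add: \<delta>_def)
  have w: "x ^ k * weight a b c d x = C * h k x" if "x \<in> {0<..<1}" for k x
  proof -
    have "x powr (a + real k - 1) = x ^ k * x powr (a - 1)"
      using that powr_add[of x "a - 1" "real k"] by (simp add: powr_realpow algebra_simps)
    then show ?thesis
      by (simp add: weight_def Let_def \<delta>_def[symmetric] C_def h_def mult_ac)
  qed
  have h: "set_integrable lborel {0<..<1} (h k)"
    "(LBINT x:{0<..<1}. h k x) = Beta (a + real k) \<delta> * S k" for k
    using moment_of_hypergeo[of "a + real k" \<delta> "c - b" "d - b"] pos \<delta>_pos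
    by (simp_all add: h_def[abs_def] S_def \<delta>_def)
  have w_int: "set_integrable lborel {0<..<1} (\<lambda>x. x ^ k * weight a b c d x)" for k
  proof -
    have "set_integrable lborel {0<..<1} (\<lambda>x. C * h k x)"
      using h(1) by simp
    then show ?thesis
      by (subst set_integrable_cong[OF refl refl w])
  qed
  then show "set_integrable lborel {0<..<1} (\<lambda>x. x ^ k * weight a b c d x)" .
  have \<mu>: "\<mu> k = C * (Beta (a + real k) \<delta> * S k)" for k
  proof -
    have "\<mu> k = (LBINT x:{0<..<1}. C * h k x)"
      unfolding \<mu>_def by (rule set_lebesgue_integral_cong) (use w in auto)
    then show ?thesis by (simp add: h)
  qed
  have rec: "(c + real k) * (d + real k) * \<mu> (Suc k) = (a + real k) * (b + real k) * \<mu> k" for k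
  proof -
    let ?e = "a + real k + \<delta>"
    \<comment> \<open>Substituting \<delta> = c + d - a - b turns the parameter differences of the
      contiguous relation into the factors expected in the moment ratio.\<close>
    have e: "?e - (c - b) = d + real k" "?e - (d - b) = c + real k"
      "?e - (c - b) - (d - b) = b + real k" "?e > 0"
      using pos \<delta>_pos by (simp_all add: \<delta>_def)
    have "(d + real k) * (c + real k) * S (Suc k) = ?e * (b + real k) * S k"
      using hypergeo_coeff_contiguous[of ?e "c - b" "d - b"] pos \<delta>_pos unfolding e
      by (simp add: S_def add_ac)
    moreover have "?e * Beta (a + real (Suc k)) \<delta> = (a + real k) * Beta (a + real k) \<delta>"
    proof -
      have "a + real k \<notin> \<int>\<^sub>\<le>\<^sub>0" using pos by (auto elim!: nonpos_Ints_cases)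
      from Beta_plus1_left[OF this, of \<delta>] show ?thesis by (simp add: add_ac)
    qed
    ultimately have "?e * ((c + real k) * (d + real k) * \<mu> (Suc k)) =
        ?e * ((a + real k) * (b + real k) * \<mu> k)"
      unfolding \<mu> by algebra
    then show ?thesis using e(4) by simp
  qed
  have "\<mu> k = \<mu> 0 * (pochhammer a k * pochhammer b k / (pochhammer c k * pochhammer d k))" for k
  proof (induction k)
    case (Suc k)
    have "c + real k > 0" "d + real k > 0" using pos by auto
    then have "\<mu> (Suc k) = \<mu> k * ((a + real k) * (b + real k) / ((c + real k) * (d + real k)))"
      using rec[of k] by (simp add: eq_divide_eq mult_ac)
    then show ?case by (simp add: Suc.IH pochhammer_Suc mult_ac)
  qed simp
  from this[of k] show "(LBINT x:{0<..<1}. x ^ k * weight a b c d x) =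
      (LBINT x:{0<..<1}. weight a b c d x) *
      (pochhammer a k * pochhammer b k / (pochhammer c k * pochhammer d k))"
    by (simp add: \<mu>_def)
qed

text \<open>Both components have the form \<open>weight a (b + j) (c + j) d\<close>, with the same
  \<delta>. Rewriting the shifted Pochhammer symbols with base b and c costs only a factor
  independent of k. It is absorbed in \<open>M\<close>, since the orthogonality sums need the
  moments only up to a constant.\<close>

lemma weight_vector_moments:
  fixes a b c d :: real
  assumes "a > 0" "b > 0" "c > 0" "d > 0" "c + d - a - b > 0" "j \<in> {0, 1}"
  shows "set_integrable lborel {0<..<1} (\<lambda>x. x ^ k * weight_vector a b c d j x)"
    and "\<exists>M. \<forall>k. (LBINT x:{0<..<1}. x ^ k * weight_vector a b c d j x) =
      M * (pochhammer a k * pochhammer b (k + j) / (pochhammer c (k + j) * pochhammer d k))"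
proof -
  define b' c' where "b' = b + real j" and "c' = c + real j"
  have pos: "b' > 0" "c' > 0" "c' + d - a - b' > 0"
    using assms by (simp_all add: b'_def c'_def)
  have wv: "weight_vector a b c d j = weight a b' c' d"
    using assms(6) by (auto simp: weight_vector_def b'_def c'_def)
  note mom = weight_moments[OF assms(1) pos(1,2) assms(4) pos(3)]
  show "set_integrable lborel {0<..<1} (\<lambda>x. x ^ k * weight_vector a b c d j x)"
    unfolding wv by (rule mom)
  have quot: "pochhammer b' k / pochhammer c' k =
      pochhammer c j / pochhammer b j * (pochhammer b (k + j) / pochhammer c (k + j))" for k
  proof -
    have "pochhammer b j > 0" "pochhammer c j > 0" "pochhammer c' k > 0"
      using assms pos by (simp_all add: pochhammer_pos)
    then show ?thesis
      using pochhammer_product'[of b j k] pochhammer_product'[of c j k]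
      by (simp add: b'_def c'_def add.commute)
  qed
  show "\<exists>M. \<forall>k. (LBINT x:{0<..<1}. x ^ k * weight_vector a b c d j x) =
      M * (pochhammer a k * pochhammer b (k + j) / (pochhammer c (k + j) * pochhammer d k))"
  proof (intro exI allI)
    fix k
    have "(LBINT x:{0<..<1}. x ^ k * weight_vector a b c d j x) =
        (LBINT x:{0<..<1}. weight a b' c' d x) *
        (pochhammer b' k / pochhammer c' k) * (pochhammer a k / pochhammer d k)"
      unfolding wv mom(2)[of k] by simp
    then show "(LBINT x:{0<..<1}. x ^ k * weight_vector a b c d j x) =
        ((LBINT x:{0<..<1}. weight a b' c' d x) * (pochhammer c j / pochhammer b j)) *
        (pochhammer a k * pochhammer b (k + j) / (pochhammer c (k + j) * pochhammer d k))"
      unfolding quot by (simp add: mult_ac)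
  qed
qed

text \<open>The bound \<open>N\<close> is free, so that polynomials of different degrees can be
  expanded over one common index range.\<close>

lemma set_lebesgue_integral_poly:
  fixes w :: "real \<Rightarrow> real"
  assumes "\<And>i. set_integrable lborel A (\<lambda>x. x ^ i * w x)" "degree p \<le> N"
  shows "(LBINT x:A. x ^ k * poly p x * w x) =
    (\<Sum>i\<le>N. coeff p i * (LBINT x:A. x ^ (i + k) * w x))"
proof -
  have int: "set_integrable lborel A (\<lambda>x. coeff p i * (x ^ (i + k) * w x))" for i
    by (intro set_integrable_mult_right assms(1))
  have "poly p x = (\<Sum>i\<le>N. coeff p i * x ^ i)" for x
    unfolding poly_altdef using assms(2)
    by (intro sum.mono_neutral_left) (auto simp: coeff_eq_0)
  then have "x ^ k * poly p x * w x = (\<Sum>i\<le>N. coeff p i * (x ^ (i + k) * w x))" for x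
    by (simp add: sum_distrib_left sum_distrib_right power_add mult_ac)
  then have "(LBINT x:A. x ^ k * poly p x * w x) =
      (\<integral>x. (\<Sum>i\<le>N. indicator A x *\<^sub>R (coeff p i * (x ^ (i + k) * w x))) \<partial>lborel)"
    by (simp add: set_lebesgue_integral_def sum_distrib_left)
  also have "\<dots> = (\<Sum>i\<le>N. (LBINT x:A. coeff p i * (x ^ (i + k) * w x)))"
    unfolding set_lebesgue_integral_def
    by (rule Bochner_Integration.integral_sum)
       (use int in \<open>simp add: set_integrable_def\<close>)
  finally show ?thesis by simp
qed

section \<open>Finite differences and orthogonality of the terminating series\<close>

text \<open>Up to sign the sum is an n-th finite difference at 0. Pascal's rule trades one order of
  the difference for passing from p(x) to p(x) - p(x + 1), which lowers the degree.\<close>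

lemma sum_alternating_choose_poly:
  fixes p :: "real poly"
  assumes "degree p < n"
  shows "(\<Sum>i\<le>n. (-1) ^ i * real (n choose i) * poly p (real i)) = 0"
  using assms
proof (induction n arbitrary: p)
  case (Suc n)
  define q where "q = p - pcompose p [:1, 1:]"
  have split: "(\<Sum>i\<le>Suc n. (-1) ^ i * real (Suc n choose i) * poly p (real i)) =
      (\<Sum>i\<le>n. (-1) ^ i * real (n choose i) * poly q (real i))"
  proof -
    have "(\<Sum>i\<le>Suc n. (-1) ^ i * real (Suc n choose i) * poly p (real i)) =
        poly p 0 + (\<Sum>i\<le>n. (-1) ^ Suc i * real (n choose Suc i) * poly p (real (Suc i)))
        + (\<Sum>i\<le>n. (-1) ^ Suc i * real (n choose i) * poly p (real (Suc i)))"
      by (subst sum.atMost_Suc_shift) (simp add: algebra_simps sum.distrib sum_negf sum_subtractf)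
    also have "poly p 0 + (\<Sum>i\<le>n. (-1) ^ Suc i * real (n choose Suc i) * poly p (real (Suc i))) =
        (\<Sum>i\<le>Suc n. (-1) ^ i * real (n choose i) * poly p (real i))"
      by (subst sum.atMost_Suc_shift) simp
    also have "\<dots> = (\<Sum>i\<le>n. (-1) ^ i * real (n choose i) * poly p (real i))"
      by simp
    finally show ?thesis
      by (simp add: q_def poly_pcompose algebra_simps sum_subtractf sum_negf)
  qed
  show ?case
  \<comment> \<open>For constant p the degree cannot drop any further, but then q vanishes
    outright.\<close>
  proof (cases "degree p = 0")
    case True
    then have "q = 0" by (auto elim!: degree_eq_zeroE simp: q_def pcompose_const)
    then show ?thesis unfolding split by simp
  next
    case False
    have "degree (pcompose p [:1, 1:]) = degree p"
      by (simp add: degree_pcompose)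
    moreover have "lead_coeff (pcompose p [:1, 1:]) = lead_coeff p"
      by (subst lead_coeff_comp) auto
    ultimately have "degree q \<le> degree p" "coeff q (degree p) = 0"
      using degree_diff_le[of p "degree p" "pcompose p [:1, 1:]"] by (simp_all add: q_def)
    then have "degree q < degree p"
      using False by (metis degree_0 le_neq_implies_less leading_coeff_0_iff neq0_conv)
    then show ?thesis using Suc unfolding split by simp
  qed
qed simp

lemma pochhammer_as_poly:
  "\<exists>p. degree p \<le> k \<and> (\<forall>x. poly p x = pochhammer (z + x) k)" for z :: real
proof (induction k)
  case 0
  show ?case by (intro exI[of _ 1]) simp
next
  case (Suc k)
  then obtain p where p: "degree p \<le> k" "\<And>x. poly p x = pochhammer (z + x) k" by blast
  have "degree (p * [:z + real k, 1:]) \<le> Suc k"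
    using degree_mult_le[of p "[:z + real k, 1:]"] p(1) by simp
  then show ?case
    by (intro exI[of _ "p * [:z + real k, 1:]"]) (simp add: p(2) pochhammer_Suc algebra_simps)
qed

text \<open>Up to normalisation the terminating series \<open>\<^sub>3F\<^sub>2(-n, \<alpha>, \<beta>; a, b; x)\<close>.\<close>

definition hypergeo_poly :: "nat \<Rightarrow> real \<Rightarrow> real \<Rightarrow> real \<Rightarrow> real \<Rightarrow> real poly" where
  "hypergeo_poly n \<alpha> \<beta> a b = (\<Sum>i\<le>n. monom ((-1) ^ i * real (n choose i) *
     (pochhammer \<alpha> i * pochhammer \<beta> i / (pochhammer a i * pochhammer b i))) i)"

lemma coeff_hypergeo_poly:
  "coeff (hypergeo_poly n \<alpha> \<beta> a b) i = (-1) ^ i * real (n choose i) *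
     (pochhammer \<alpha> i * pochhammer \<beta> i / (pochhammer a i * pochhammer b i))"
  by (cases "i \<le> n") (auto simp: hypergeo_poly_def coeff_sum coeff_monom)

lemma degree_hypergeo_poly_le: "degree (hypergeo_poly n \<alpha> \<beta> a b) \<le> n"
  by (rule degree_le) (simp add: coeff_hypergeo_poly)

text \<open>After cancellation, the Pochhammer quotients are polynomials in i: those in a and b have
  degrees k and l, those in c and d have degrees r - l and s - k. The total r + s is below n, so the
  alternating binomial sum vanishes.\<close>

lemma hypergeo_poly_orthogonal:
  assumes "a > 0" "b > 0" "c > 0" "d > 0" "l \<le> r" "k \<le> s" "r + s < n"
  shows "(\<Sum>i\<le>n. coeff (hypergeo_poly n (c + real r) (d + real s) a b) i *
    (pochhammer a (i + k) * pochhammer b (i + l) /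
      (pochhammer c (i + l) * pochhammer d (i + k)))) = 0"
proof -
  obtain pa where pa: "degree pa \<le> k" "\<And>x. poly pa x = pochhammer (a + x) k"
    using pochhammer_as_poly by blast
  obtain pb where pb: "degree pb \<le> l" "\<And>x. poly pb x = pochhammer (b + x) l"
    using pochhammer_as_poly by blast
  obtain pc where pc: "degree pc \<le> r - l" "\<And>x. poly pc x = pochhammer (c + real l + x) (r - l)"
    using pochhammer_as_poly by blast
  obtain pd where pd: "degree pd \<le> s - k" "\<And>x. poly pd x = pochhammer (d + real k + x) (s - k)"
    using pochhammer_as_poly by blast
  have num: "pochhammer z (i + m) = pochhammer z i * pochhammer (z + real i) m" for z :: real and i m
    by (rule pochhammer_product')
  have den: "pochhammer (z + real m) i / pochhammer z (i + t) =
      pochhammer (z + real t + real i) (m - t) / pochhammer z m"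
    if "z > 0" "t \<le> m" for z :: real and i m t
  proof -
    have "pochhammer z (i + t) * pochhammer (z + real t + real i) (m - t) = pochhammer z (m + i)"
      using pochhammer_product'[of z "i + t" "m - t"] that by (simp add: add_ac)
    also have "\<dots> = pochhammer z m * pochhammer (z + real m) i"
      by (rule pochhammer_product')
    finally show ?thesis
      using that pochhammer_pos[of z "i + t"] pochhammer_pos[of z m] by (simp add: field_simps)
  qed
  have summand: "coeff (hypergeo_poly n (c + real r) (d + real s) a b) i *
      (pochhammer a (i + k) * pochhammer b (i + l) /
        (pochhammer c (i + l) * pochhammer d (i + k))) =
      (-1) ^ i * real (n choose i) * poly (pa * pb * pc * pd) (real i) *
      (1 / (pochhammer c r * pochhammer d s))" for i
  proof -
    have "pochhammer a i > 0" "pochhammer b i > 0"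
      using assms by (simp_all add: pochhammer_pos)
    then have "coeff (hypergeo_poly n (c + real r) (d + real s) a b) i *
      (pochhammer a (i + k) * pochhammer b (i + l) /
        (pochhammer c (i + l) * pochhammer d (i + k))) =
      (-1) ^ i * real (n choose i) * (pochhammer (a + real i) k * pochhammer (b + real i) l) *
      ((pochhammer (c + real r) i / pochhammer c (i + l)) *
       (pochhammer (d + real s) i / pochhammer d (i + k)))"
      unfolding coeff_hypergeo_poly num[of a] num[of b] by simp
    then show ?thesis
      unfolding den[OF assms(3,5)] den[OF assms(4,6)] by (simp add: pa pb pc pd)
  qed
  have "degree (pa * pb * pc * pd) \<le> degree pa + degree pb + degree pc + degree pd"
    by (meson add_le_mono1 degree_mult_le order_trans)
  also have "\<dots> < n" using pa(1) pb(1) pc(1) pd(1) assms by linarith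
  finally have "(\<Sum>i\<le>n. (-1) ^ i * real (n choose i) * poly (pa * pb * pc * pd) (real i)) = 0"
    by (rule sum_alternating_choose_poly)
  then show ?thesis unfolding summand sum_distrib_right[symmetric] by simp
qed

section \<open>The hypergeometric differential equation\<close>

text \<open>With \<theta> = x d/dx, this is \<theta>(\<theta> + a - 1)(\<theta> + b - 1) y =
  x(\<theta> - n)(\<theta> + \<alpha>)(\<theta> + \<beta>) y divided by x. Comparing coefficients
  reduces it to the two-term recurrence \<open>rec\<close>.\<close>

lemma hypergeo_poly_ode:
  fixes a b \<alpha> \<beta> :: real and n :: nat
  assumes "a > 0" "b > 0"
  defines "y \<equiv> hypergeo_poly n \<alpha> \<beta> a b"
  shows "x ^ 2 * (1 - x) * poly (pderiv (pderiv (pderiv y))) x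
      - x * ((\<alpha> + \<beta> - real n + 3) * x - (a + b + 1)) * poly (pderiv (pderiv y)) x
      + (((real n - 1) * (\<alpha> + \<beta> + 1) - \<alpha> * \<beta>) * x + a * b) * poly (pderiv y) x
      + real n * (\<alpha> * \<beta>) * poly y x = 0"
proof -
  have rec: "real (Suc i) * (a + real i) * (b + real i) * coeff y (Suc i) =
      - (real n - real i) * (\<alpha> + real i) * (\<beta> + real i) * coeff y i" for i
  proof -
    \<comment> \<open>The subtraction is in the reals, so the identity holds for every i; beyond n
      both binomial coefficients vanish.\<close>
    have ch: "real (Suc i) * real (n choose Suc i) = (real n - real i) * real (n choose i)"
    proof (cases "i \<le> n")
      case True
      have "Suc i * (n choose Suc i) = (n - i) * (n choose i)"
        using binomial_absorb_comp[of n i] binomial_absorption[of i n] by simp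
      then show ?thesis using True by (metis of_nat_diff of_nat_mult)
    qed (simp add: binomial_eq_0)
    have "pochhammer a i > 0" "pochhammer b i > 0" "a + real i > 0" "b + real i > 0"
      using assms by (simp_all add: pochhammer_pos)
    then have "real (Suc i) * (a + real i) * (b + real i) * coeff y (Suc i) =
       - (real (Suc i) * real (n choose Suc i)) * ((-1) ^ i * (\<alpha> + real i) * (\<beta> + real i) *
        (pochhammer \<alpha> i * pochhammer \<beta> i / (pochhammer a i * pochhammer b i)))"
      by (simp add: y_def coeff_hypergeo_poly pochhammer_Suc del: of_nat_Suc)
    also have "\<dots> = - (real n - real i) * (\<alpha> + real i) * (\<beta> + real i) * coeff y i"
      unfolding ch y_def coeff_hypergeo_poly by (simp only: mult_minus_left mult_minus_right mult_ac)
    finally show ?thesis .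
  qed
  define E where "E = monom 1 2 * pderiv (pderiv (pderiv y)) - monom 1 3 * pderiv (pderiv (pderiv y))
    - monom (\<alpha> + \<beta> - real n + 3) 2 * pderiv (pderiv y) + monom (a + b + 1) 1 * pderiv (pderiv y)
    + monom ((real n - 1) * (\<alpha> + \<beta> + 1) - \<alpha> * \<beta>) 1 * pderiv y + monom (a * b) 0 * pderiv y
    + monom (real n * (\<alpha> * \<beta>)) 0 * y"
  have "coeff E i = 0" for i
  proof -
    have "coeff E i = real (Suc i) * (a + real i) * (b + real i) * coeff y (Suc i)
       + (real n - real i) * (\<alpha> + real i) * (\<beta> + real i) * coeff y i"
    proof -
      \<comment> \<open>Multiplication by monomials of degree up to 3 shifts indices, so the
        coefficients below 3 are computed separately.\<close>
      consider "i = 0" | "i = 1" | "i = 2" | j where "i = Suc (Suc (Suc j))"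
        by (metis One_nat_def Suc_1 not0_implies_Suc)
      then show ?thesis
        unfolding E_def coeff_add coeff_diff coeff_monom_mult coeff_pderiv
        by cases (simp_all add: numeral_3_eq_3 numeral_2_eq_2 algebra_simps)
    qed
    then show ?thesis unfolding rec by algebra
  qed
  then have "E = 0" by (simp add: poly_eqI)
  then have "poly E x = 0" by simp
  then show ?thesis
    by (simp add: E_def poly_monom algebra_simps power2_eq_square power3_eq_cube)
qed

section \<open>Uniqueness of the monic solution\<close>

text \<open>The matrix of the values \<open>L m (P i)\<close> is triangular with nonzero diagonal.
  The difference \<open>Q - P n\<close> has degree below n or is zero, hence is a combination of the
  \<open>P i\<close> with i < n; applying L 0, L 1, ... in turn shows that its coefficients
  vanish.\<close>

lemma monic_dual_basis_unique:
  fixes L :: "nat \<Rightarrow> 'a::field poly \<Rightarrow> 'a" and P :: "nat \<Rightarrow> 'a poly"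
  assumes add: "\<And>m p q. L m (p + q) = L m p + L m q"
    and smult: "\<And>m c p. L m (smult c p) = c * L m p"
    and P: "\<And>n. degree (P n) = n" "\<And>n. lead_coeff (P n) = 1"
    and zero: "\<And>m n. m < n \<Longrightarrow> L m (P n) = 0"
    and nonzero: "\<And>n. L n (P n) \<noteq> 0"
    and Q: "degree Q = n" "lead_coeff Q = 1" "\<And>m. m < n \<Longrightarrow> L m Q = 0"
  shows "Q = P n"
proof -
  have L0: "L m 0 = 0" for m
    using smult[of m 0 0] by simp
  have L_sum: "L m (\<Sum>i<N. smult (e i) (P i)) = (\<Sum>i<N. e i * L m (P i))" for m N e
    by (induction N) (simp_all add: L0 add smult)
  have span: "\<exists>e. p = (\<Sum>i<N. smult (e i) (P i))" if "p = 0 \<or> degree p < N" for p N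
    using that
  proof (induction N arbitrary: p)
    case (Suc N)
    define q where "q = p - smult (coeff p N) (P N)"
    have "degree p \<le> N" using Suc.prems by auto
    then have "degree q \<le> N" "coeff q N = 0"
      using P[of N] by (auto simp: q_def intro: degree_diff_le order_trans[OF degree_smult_le])
    then have "q = 0 \<or> degree q < N"
      by (metis le_neq_implies_less leading_coeff_0_iff)
    then obtain e where e: "q = (\<Sum>i<N. smult (e i) (P i))"
      using Suc.IH by blast
    have "p = q + smult (coeff p N) (P N)" by (simp add: q_def)
    also have "\<dots> = (\<Sum>i<Suc N. smult ((e(N := coeff p N)) i) (P i))"
      unfolding e by simp
    finally show ?case by blast
  qed auto
  define D where "D = Q - P n"
  have "degree D \<le> n" "coeff D n = 0"
    using P[of n] Q(1,2) by (auto simp: D_def intro: degree_diff_le)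
  then have "D = 0 \<or> degree D < n"
    by (metis le_neq_implies_less leading_coeff_0_iff)
  then obtain e where e: "D = (\<Sum>i<n. smult (e i) (P i))"
    using span by blast
  have LD: "L m D = 0" if "m < n" for m
  proof -
    have "L m Q = L m D + L m (P n)" unfolding add[symmetric] by (simp add: D_def)
    then show ?thesis using Q(3) zero that by simp
  qed
  have "e m = 0" if "m < n" for m
    using that
  proof (induction m rule: less_induct)
    case (less m)
    have "e i * L m (P i) = (if i = m then e m * L m (P m) else 0)" if "i < n" for i
      using less zero[of m i] that by (cases i m rule: linorder_cases) auto
    then have "L m D = (\<Sum>i<n. if i = m then e m * L m (P m) else 0)"
      unfolding e L_sum by (intro sum.cong) auto
    also have "\<dots> = e m * L m (P m)" using less.prems by simp
    finally show ?case using LD[OF less.prems] nonzero by simp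
  qed
  then have "D = 0" unfolding e by simp
  then show ?thesis by (simp add: D_def)
qed


section \<open>Identification of \<open>P n\<close> with the terminating series, and the
  conclusion\<close>

text \<open>Positivity of n matters: at n = 0 the integer floor is -1, while truncated
  \<open>(n - 1) div 2\<close> is 0.\<close>

lemma lambda_coeff_eq:
  assumes "n > 0"
  shows "lambda_coeff c d n = (c + real (n div 2)) * (d + real ((n - 1) div 2))"
proof -
  have "(real n - 1) / 2 = real (n - 1) / real 2" using assms by simp
  then show ?thesis
    using floor_divide_of_nat_eq[of n 2, where 'a = real] floor_divide_of_nat_eq[of "n - 1" 2, where 'a = real]
    by (simp add: lambda_coeff_def)
qed

lemma monic_2_orthogonal_eq_hypergeo_poly:
  fixes a b c d :: real
  assumes pos: "a > 0" "b > 0" "c > 0" "d > 0" "c + d - a - b > 0"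
    and orth: "monic_2_orthogonal (weight_vector a b c d) P" and "n > 0"
  shows "\<exists>C. P n = smult C (hypergeo_poly n (c + real (n div 2)) (d + real ((n - 1) div 2)) a b)"
proof -
  define H where "H = hypergeo_poly n (c + real (n div 2)) (d + real ((n - 1) div 2)) a b"
  define C where "C = inverse (coeff H n)"
  define w where "w j = weight_vector a b c d j" for j
  \<comment> \<open>Writing m = 2k + j merges the conditions for both weights into one sequence of
    functionals, for which 2-orthogonality is exactly triangularity.\<close>
  define L where "L m p = (LBINT x:{0<..<1}. x ^ (m div 2) * poly p x * w (m mod 2) x)" for m p
  have w_int: "set_integrable lborel {0<..<1} (\<lambda>x. x ^ i * w (m mod 2) x)" for i m
    unfolding w_def by (rule weight_vector_moments(1)[OF pos]) auto
  have L_eq: "L m p = (\<Sum>i\<le>N. coeff p i * (LBINT x:{0<..<1}. x ^ (i + m div 2) * w (m mod 2) x))"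
    if "degree p \<le> N" for m p N
    unfolding L_def by (rule set_lebesgue_integral_poly[OF w_int that])
  have H_n: "coeff H n \<noteq> 0"
    using pochhammer_pos[of a n] pochhammer_pos[of b n]
      pochhammer_pos[of "c + real (n div 2)" n] pochhammer_pos[of "d + real ((n - 1) div 2)" n] pos
    by (simp add: H_def coeff_hypergeo_poly)
  have deg_H: "degree H = n"
    using degree_hypergeo_poly_le le_degree[OF H_n] by (simp add: H_def order_antisym)
  have L_add: "L m (p + q) = L m p + L m q" for m p q
  proof -
    define N where "N = max (degree p) (degree q)"
    have "degree p \<le> N" "degree q \<le> N" "degree (p + q) \<le> N"
      by (auto simp: N_def degree_add_le_max)
    from this[THEN L_eq] show ?thesis
      by (simp add: sum.distrib distrib_right)
  qed
  have L_smult: "L m (smult e p) = e * L m p" for m e p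
    using L_eq[of "smult e p" "degree p" m] L_eq[of p "degree p" m]
    by (simp add: degree_smult_le sum_distrib_left mult.assoc)
  have L_H: "L m H = 0" if "m < n" for m
  proof -
    define k j where "k = m div 2" and "j = m mod 2"
    have j: "j \<in> {0, 1}" unfolding j_def by auto
    obtain M where M: "\<And>i. (LBINT x:{0<..<1}. x ^ i * w j x) =
        M * (pochhammer a i * pochhammer b (i + j) / (pochhammer c (i + j) * pochhammer d i))"
      using weight_vector_moments(2)[OF pos j] unfolding w_def by blast
    have "L m H = (\<Sum>i\<le>n. coeff H i * (LBINT x:{0<..<1}. x ^ (i + k) * w j x))"
      using L_eq[of H n m] deg_H by (simp add: k_def j_def)
    also have "\<dots> = M * (\<Sum>i\<le>n. coeff H i * (pochhammer a (i + k) * pochhammer b (i + (k + j)) /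
        (pochhammer c (i + (k + j)) * pochhammer d (i + k))))"
      unfolding M by (simp add: sum_distrib_left mult.left_commute add.assoc)
    also have "(\<Sum>i\<le>n. coeff H i * (pochhammer a (i + k) * pochhammer b (i + (k + j)) /
        (pochhammer c (i + (k + j)) * pochhammer d (i + k)))) = 0"
      unfolding H_def
    proof (rule hypergeo_poly_orthogonal[OF pos(1-4)])
      \<comment> \<open>Here k and k + j are m/2 rounded down and up, and m is at most n - 1. The
        two upper shifts add up to n - 1, the largest value the degree count admits.\<close>
      show "k + j \<le> n div 2" "k \<le> (n - 1) div 2" "n div 2 + (n - 1) div 2 < n"
        using that by (simp_all add: k_def j_def) presburger+
    qed
    finally show ?thesis by simp
  qed
  have "\<forall>i. degree (P i) = i \<and> lead_coeff (P i) = 1"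
    using orth unfolding monic_2_orthogonal_def by (rule conjunct1)
  then have P: "degree (P i) = i" "lead_coeff (P i) = 1" for i
    by blast+
  have L_P: "(m < i \<longrightarrow> L m (P i) = 0) \<and> (i = m \<longrightarrow> L m (P i) \<noteq> 0)" for m i
  proof -
    have "m mod 2 \<in> {0, 1}" by auto
    from bspec[OF conjunct2[OF orth[unfolded monic_2_orthogonal_def]] this]
    have "(i \<ge> 2 * (m div 2) + m mod 2 + 1 \<longrightarrow> L m (P i) = 0) \<and>
        (i = 2 * (m div 2) + m mod 2 \<longrightarrow> L m (P i) \<noteq> 0)"
      unfolding L_def w_def by (elim allE[where x = "m div 2"] allE[where x = i])
    then show ?thesis by simp
  qed
  have "smult C H = P n"
  proof (rule monic_dual_basis_unique[where L = L, OF L_add L_smult P])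
    show "L m (P i) = 0" if "m < i" for m i using L_P that by blast
    show "L i (P i) \<noteq> 0" for i using L_P by blast
    show "degree (smult C H) = n" "lead_coeff (smult C H) = 1"
      using deg_H H_n by (simp_all add: C_def)
    show "L m (smult C H) = 0" if "m < n" for m
      using L_H[OF that] by (simp add: L_smult)
  qed
  then show ?thesis unfolding H_def by metis
qed

theorem theorem3p3:
  fixes a b c d :: real and P :: "nat \<Rightarrow> real poly"
  assumes "a > 0" and "b > 0" and "c > 0" and "d > 0"
    and "min c d > max a b"
    and "monic_2_orthogonal (weight_vector a b c d) P"
  shows "\<forall>n::nat. \<forall>x::real.
      x ^ 2 * (1 - x) * poly (pderiv (pderiv (pderiv (P n)))) x
      - x * phi_coeff a b c d x * poly (pderiv (pderiv (P n))) x
      + psi_coeff a b c d n x * poly (pderiv (P n)) x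
      + real n * lambda_coeff c d n * poly (P n) x = 0"
proof (intro allI)
  fix n :: nat and x :: real
  show "x ^ 2 * (1 - x) * poly (pderiv (pderiv (pderiv (P n)))) x
      - x * phi_coeff a b c d x * poly (pderiv (pderiv (P n))) x
      + psi_coeff a b c d n x * poly (pderiv (P n)) x
      + real n * lambda_coeff c d n * poly (P n) x = 0"
  \<comment> \<open>For n = 0 the polynomial is constant and the factor n kills the last term; the
    identification with the series is available for n > 0.\<close>
  proof (cases "n = 0")
    case True
    have "degree (P n) = 0"
      using assms(6) True by (simp add: monic_2_orthogonal_def)
    then have "pderiv (P n) = 0" by (simp add: pderiv_eq_0_iff)
    then show ?thesis using True by simp
  next
    case False
    define \<alpha> \<beta> where "\<alpha> = c + real (n div 2)" and "\<beta> = d + real ((n - 1) div 2)"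
    define y where "y = hypergeo_poly n \<alpha> \<beta> a b"
    have "c + d - a - b > 0" using assms(5) by linarith
    then obtain C where C: "P n = smult C y"
      using monic_2_orthogonal_eq_hypergeo_poly[OF assms(1-4) _ assms(6)] False
      unfolding y_def \<alpha>_def \<beta>_def by blast
    \<comment> \<open>Whatever the parity of n, the two shifts sum to n - 1, so \<alpha> + \<beta> =
      c + d + n - 1; this yields the coefficients of \<phi> and \<psi>.\<close>
    have "n div 2 + (n - 1) div 2 + 1 = n" using False by presburger
    then have "real (n div 2) + real ((n - 1) div 2) + 1 = real n"
      by (metis of_nat_1 of_nat_add)
    then have sum: "\<alpha> + \<beta> - real n + 3 = c + d + 2" "\<alpha> + \<beta> + 1 = c + d + real n"
      by (simp_all add: \<alpha>_def \<beta>_def)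
    have \<lambda>: "lambda_coeff c d n = \<alpha> * \<beta>"
      using False by (simp add: lambda_coeff_eq \<alpha>_def \<beta>_def)
    have "x ^ 2 * (1 - x) * poly (pderiv (pderiv (pderiv y))) x
      - x * phi_coeff a b c d x * poly (pderiv (pderiv y)) x
      + psi_coeff a b c d n x * poly (pderiv y) x
      + real n * lambda_coeff c d n * poly y x = 0"
      using hypergeo_poly_ode[OF assms(1,2), of x n \<alpha> \<beta>]
      unfolding y_def phi_coeff_def psi_coeff_def \<lambda> sum .
    moreover have "x ^ 2 * (1 - x) * poly (pderiv (pderiv (pderiv (P n)))) x
      - x * phi_coeff a b c d x * poly (pderiv (pderiv (P n))) x
      + psi_coeff a b c d n x * poly (pderiv (P n)) x
      + real n * lambda_coeff c d n * poly (P n) x =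
      C * (x ^ 2 * (1 - x) * poly (pderiv (pderiv (pderiv y))) x
      - x * phi_coeff a b c d x * poly (pderiv (pderiv y)) x
      + psi_coeff a b c d n x * poly (pderiv y) x
      + real n * lambda_coeff c d n * poly y x)"
      by (simp add: C pderiv_smult algebra_simps)
    ultimately show ?thesis by simp
  qed
qed

end
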